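(* Let $G$ be a graph with at least one edge. Then $$\operatorname{coind}_{\mathbb{Z}_2}\operatorname{Hom}(K_2, G)\le\lim_{r\to\infty}\operatorname{coind}_{\mathbb{Z}_2}\operatorname{Hom}(C_{2r+1}, G)+1.$$
   Context: All graphs are finite, simple and without loops. $K_2$ is the graph with vertices $0,1$ and the edge $\{0,1\}$; $C_n$ ($n\ge 3$) is the cycle of length $n$ with vertex set $\{0,\dots,n-1\}$ and edges $\{i,i+1\}$ (mod $n$). A multi-homomorphism from $G$ to $H$ is a function $\phi\colon V(G)\to\mathcal P(V(H))\setminus\{\emptyset\}$ such that every function $f\colon V(G)\to V(H)$ with $f(v)\in\phi(v)$ for all $v$ is a graph homomorphism. $\operatorname{Hom}(G,H)$ is the subcomplex of the cell complex $\prod_{v\in V(G)}\Delta^{\#V(H)-1}$ (each factor being the simplex with vertex set $V(H)$) consisting of the cells $\prod_v\phi(v)$ indexed by the multi-homomorphisms $\phi$. An involution $\alpha$ of $H$ induces the involution $(x_v)_v\mapsto(x_{\alpha(v)})_v$ of $\operatorname{Hom}(H,G)$. $\operatorname{Hom}(K_2,G)$ and $\operatorname{Hom}(C_m,G)$ are free $\mathbb{Z}_2$-spaces via the involutions $v\mapsto 1-v$ of $K_2$ and $v\mapsto m-1-v$ of $C_m$. For a free $\mathbb{Z}_2$-space $X$, $\operatorname{coind}_{\mathbb{Z}_2}X=\max\{k:\text{there is a }\mathbb{Z}_2\text{-map }\mathbb{S}^k\to X\}$, where $\mathbb{S}^k$ carries the antipodal action, $k\ge-1$ and $\mathbb{S}^{-1}=\emptyset$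 (so $\operatorname{coind}_{\mathbb{Z}_2}\emptyset=-1$). The sequence $\operatorname{coind}_{\mathbb{Z}_2}\operatorname{Hom}(C_{2r+1},G)$ is nondecreasing in $r\ge1$, because the graph homomorphisms $C_{m+2}\to C_m$, $i\mapsto i-1$ (mod $m$), commute with the involutions and induce $\mathbb{Z}_2$-maps $\operatorname{Hom}(C_m,G)\to\operatorname{Hom}(C_{m+2},G)$; the right hand side uses its limit. *)

theory Defs
  imports "HOL-Analysis.Analysis" "Graph_Theory.Pair_Digraph"
begin

text \<open>
  Finite simple graphs are rendered by the locale \<^locale>\<open>pair_graph\<close>: an edge \<open>{u, v}\<close>
  is represented by the two arcs \<open>(u, v)\<close> and \<open>(v, u)\<close>.
\<close>

definition K2 :: "nat pair_pre_digraph" where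
  "K2 = \<lparr>pverts = {0, 1}, parcs = {(0, 1), (1, 0)}\<rparr>"

text \<open>Only \<open>n \<ge> 3\<close> is meaningful; for \<open>n = 1\<close> it is a single vertex with a loop.\<close>

definition cycle_graph :: "nat \<Rightarrow> nat pair_pre_digraph" where
  "cycle_graph n =
     \<lparr>pverts = {0..<n},
      parcs = {(i, (i + 1) mod n) | i. i < n} \<union> {((i + 1) mod n, i) | i. i < n}\<rparr>"

definition graph_hom :: "'a pair_pre_digraph \<Rightarrow> 'b pair_pre_digraph \<Rightarrow> ('a \<Rightarrow> 'b) \<Rightarrow> bool" where
  "graph_hom G H f \<longleftrightarrow>
     (\<forall>v\<in>pverts G. f v \<in> pverts H) \<and> (\<forall>(u, v)\<in>parcs G. (f u, f v) \<in> parcs H)"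

definition multi_hom :: "'a pair_pre_digraph \<Rightarrow> 'b pair_pre_digraph \<Rightarrow> ('a \<Rightarrow> 'b set) \<Rightarrow> bool" where
  "multi_hom G H \<phi> \<longleftrightarrow>
     (\<forall>v\<in>pverts G. \<phi> v \<subseteq> pverts H \<and> \<phi> v \<noteq> {}) \<and>
     (\<forall>f. (\<forall>v\<in>pverts G. f v \<in> \<phi> v) \<longrightarrow> graph_hom G H f)"

text \<open>
  The geometric simplex with vertex set \<open>W\<close>, in barycentric coordinates, and its face spanned by
  \<open>S \<subseteq> W\<close>. As in \<^const>\<open>product_topology\<close>, a family indexed by \<open>W\<close> is a
  function that is \<^const>\<open>undefined\<close> outside \<open>W\<close>.
\<close>

definition simplex_face :: "'b set \<Rightarrow> 'b set \<Rightarrow> ('b \<Rightarrow> real) set" where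
  "simplex_face W S =
     {t \<in> W \<rightarrow>\<^sub>E {0..}. (\<Sum>w\<in>W. t w) = 1 \<and> (\<forall>w\<in>W - S. t w = 0)}"

definition simplex_topology :: "'b set \<Rightarrow> ('b \<Rightarrow> real) topology" where
  "simplex_topology W =
     subtopology (product_topology (\<lambda>_. euclideanreal) W) (simplex_face W W)"

text \<open>
  For finite \<open>G\<close> and \<open>H\<close> the cell complex is finite, so its topology is the subspace
  topology of the product of simplices.
\<close>

definition Hom_complex ::
    "'a pair_pre_digraph \<Rightarrow> 'b pair_pre_digraph \<Rightarrow> ('a \<Rightarrow> 'b \<Rightarrow> real) topology" where
  "Hom_complex G H =
     subtopology (product_topology (\<lambda>_. simplex_topology (pverts H)) (pverts G))
       (\<Union>\<phi>\<in>{\<phi>. multi_hom G H \<phi>}. \<Pi>\<^sub>E v\<in>pverts G. simplex_face (pverts H) (\<phi> v))"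

definition Hom_involution ::
    "'a pair_pre_digraph \<Rightarrow> ('a \<Rightarrow> 'a) \<Rightarrow> ('a \<Rightarrow> 'b \<Rightarrow> real) \<Rightarrow> ('a \<Rightarrow> 'b \<Rightarrow> real)" where
  "Hom_involution H \<alpha> x = (\<lambda>v\<in>pverts H. x (\<alpha> v))"

definition Z2_map ::
    "'a topology \<Rightarrow> ('a \<Rightarrow> 'a) \<Rightarrow> 'b topology \<Rightarrow> ('b \<Rightarrow> 'b) \<Rightarrow> ('a \<Rightarrow> 'b) \<Rightarrow> bool" where
  "Z2_map X \<alpha> Y \<beta> f \<longleftrightarrow>
     continuous_map X Y f \<and> (\<forall>x\<in>topspace X. f (\<alpha> x) = \<beta> (f x))"

definition sphere_top :: "int \<Rightarrow> (nat \<Rightarrow> real) topology" where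
  "sphere_top k = (if k < 0 then discrete_topology {} else nsphere (nat k))"

definition antipode :: "(nat \<Rightarrow> real) \<Rightarrow> nat \<Rightarrow> real" where
  "antipode x = (\<lambda>i. - x i)"

text \<open>
  The supremum is taken in the extended reals. As \<open>- 1\<close> always belongs to the set, it is
  the maximum whenever that exists, and \<open>\<infinity>\<close> otherwise.
\<close>

definition coind :: "'a topology \<Rightarrow> ('a \<Rightarrow> 'a) \<Rightarrow> ereal" where
  "coind X \<alpha> =
     (SUP k\<in>{k::int. k \<ge> -1 \<and> (\<exists>f. Z2_map (sphere_top k) antipode X \<alpha> f)}.
        ereal (real_of_int k))"

definition coind_Hom_K2 :: "'a pair_pre_digraph \<Rightarrow> ereal" where
  "coind_Hom_K2 G = coind (Hom_complex K2 G) (Hom_involution K2 (\<lambda>v. 1 - v))"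

definition coind_Hom_cycle :: "nat \<Rightarrow> 'a pair_pre_digraph \<Rightarrow> ereal" where
  "coind_Hom_cycle m G =
     coind (Hom_complex (cycle_graph m) G) (Hom_involution (cycle_graph m) (\<lambda>v. m - 1 - v))"

end

theory Submission
  imports Defs
begin

text \<open>
  It suffices to turn a \<open>\<int>\<^sub>2\<close>-map \<open>f\<close> from the sphere of dimension \<open>n + 1\<close> to \<open>Hom(K\<^sub>2, G)\<close> into a
  \<open>\<int>\<^sub>2\<close>-map from the sphere of dimension \<open>n\<close> to \<open>Hom(C\<^sub>m, G)\<close> for some odd \<open>m = 2 r + 1 \<ge> 3\<close>. A point
  \<open>y\<close> of the equator determines a half circle from \<open>y\<close> through the pole to \<open>-y\<close>. Along it, \<open>f\<close> is a
  path of edges of \<open>G\<close>, in barycentric coordinates, that starts at \<open>f y\<close> and ends at \<open>f y\<close> with its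
  ends exchanged. A closed walk of odd length in \<open>G\<close> is obtained by reading off the two ends of these
  edges alternately at \<open>2 r + 1\<close> equidistant points of the half circle: the last and the first entry
  are ends of the same parity over antipodal points, hence opposite ends of the one edge \<open>f y\<close>. The
  half circle of \<open>-y\<close> is the reverse of that of \<open>y\<close>, and since \<open>2 r\<close> is even, reversing the sample
  points preserves parity. The construction is therefore equivariant for the reflection of the cycle.

  The one obstacle is that entries over neighbouring sample points need not be adjacent, because the
  supports of barycentric coordinates can grow under small changes. Truncating all coordinates at a
  threshold \<open>\<epsilon>\<close> removes it: if \<open>f\<close> varies by less than \<open>\<epsilon>\<close> between neighbouring sample points, then
  every vertex that survives truncation at one of them lies in the support at the other. Uniform
  continuity on the compact equator times the unit interval provides a suitable \<open>r\<close> for all \<open>y\<close>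
  simultaneously. This is \<open>Z2_map_Hom_cycle_of_Hom_K2\<close>; it rests on the description of the points
  of a Hom complex by adjacency of supports, \<open>topspace_Hom_complex_iff\<close>.

  Finally, the coindices for odd cycles do not decrease with the length (\<open>coind_Hom_cycle_mono\<close>), so
  their limit exists and is an upper bound for each of them. A coindex is at least \<open>-1\<close>, which
  settles the maps to \<open>Hom(K\<^sub>2, G)\<close> from spheres of dimension at most 0.
\<close>

section \<open>Points of the Hom complex\<close>

lemma simplex_face_mono: "S \<subseteq> T \<Longrightarrow> simplex_face W S \<subseteq> simplex_face W T"
  by (auto simp: simplex_face_def)

lemma topspace_simplex_topology: "topspace (simplex_topology W) = simplex_face W W"
  by (auto simp: simplex_topology_def simplex_face_def PiE_def)

text \<open>
  Given a point \<open>x\<close> whose coordinates have pairwise joined supports along the arcs of \<open>H\<close>, the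
  supports themselves form a multi-homomorphism, and its cell contains \<open>x\<close>. For the converse,
  vertices \<open>a\<close> and \<open>b\<close> in the supports at the two ends of an arc are the values of a single
  function chosen from the multi-homomorphism. This is where \<open>H\<close> must be loop-free: at a loop one
  function cannot take both values. In this form membership in the complex can be checked without
  ever naming a cell.
\<close>

lemma topspace_Hom_complex_iff:
  fixes H :: "'b pair_pre_digraph" and G :: "'a pair_pre_digraph"
  assumes "pair_loopfree_digraph H"
  shows "x \<in> topspace (Hom_complex H G) \<longleftrightarrow>
    x \<in> (\<Pi>\<^sub>E v\<in>pverts H. simplex_face (pverts G) (pverts G)) \<and>
    (\<forall>(u, v)\<in>parcs H. \<forall>a\<in>pverts G. \<forall>b\<in>pverts G.
       x u a \<noteq> 0 \<longrightarrow> x v b \<noteq> 0 \<longrightarrow> (a, b) \<in> parcs G)"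
    (is "?l \<longleftrightarrow> ?x \<and> ?arcs")
proof
  interpret H: pair_loopfree_digraph H by fact
  assume ?l
  then obtain \<phi> where \<phi>: "multi_hom H G \<phi>"
    and x: "x \<in> (\<Pi>\<^sub>E v\<in>pverts H. simplex_face (pverts G) (\<phi> v))"
    by (auto simp: Hom_complex_def)
  have "simplex_face (pverts G) (\<phi> v) \<subseteq> simplex_face (pverts G) (pverts G)" if "v \<in> pverts H" for v
    using \<phi> that by (intro simplex_face_mono) (auto simp: multi_hom_def)
  with x have ?x
    by (auto simp: PiE_iff)
  moreover have ?arcs
  proof clarify
    fix u v a b
    assume uv: "(u, v) \<in> parcs H" and ab: "a \<in> pverts G" "b \<in> pverts G" "x u a \<noteq> 0" "x v b \<noteq> 0"
    have verts: "u \<in> pverts H" "v \<in> pverts H" "u \<noteq> v"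
      using H.arc_fst_in_verts[OF uv] H.arc_snd_in_verts[OF uv] H.pair_no_loops[OF uv] by auto
    with x have "x u \<in> simplex_face (pverts G) (\<phi> u)" "x v \<in> simplex_face (pverts G) (\<phi> v)"
      by auto
    with ab have "a \<in> \<phi> u" "b \<in> \<phi> v"
      by (auto simp: simplex_face_def)
    \<comment> \<open>away from the arc \<open>(u, v)\<close> any element of the multi-homomorphism will do\<close>
    define f where "f w = (if w = u then a else if w = v then b else SOME c. c \<in> \<phi> w)" for w
    have "f w \<in> \<phi> w" if "w \<in> pverts H" for w
      using \<phi> that \<open>a \<in> \<phi> u\<close> \<open>b \<in> \<phi> v\<close> by (auto simp: f_def multi_hom_def some_in_eq)
    then have "graph_hom H G f"
      using \<phi> by (simp add: multi_hom_def)
    with uv have "(f u, f v) \<in> parcs G"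
      by (auto simp: graph_hom_def)
    with verts show "(a, b) \<in> parcs G"
      by (simp add: f_def)
  qed
  ultimately show "?x \<and> ?arcs" ..
next
  interpret H: pair_loopfree_digraph H by fact
  assume R: "?x \<and> ?arcs"
  define \<phi> where "\<phi> v = {a \<in> pverts G. x v a \<noteq> 0}" for v
  have "\<phi> v \<noteq> {}" if "v \<in> pverts H" for v
  proof
    assume "\<phi> v = {}"
    then have "(\<Sum>a\<in>pverts G. x v a) = 0"
      by (intro sum.neutral) (auto simp: \<phi>_def)
    with R that show False
      by (auto simp: simplex_face_def PiE_iff)
  qed
  moreover have "graph_hom H G f" if f: "\<forall>v\<in>pverts H. f v \<in> \<phi> v" for f
  proof -
    have "(f u, f v) \<in> parcs G" if uv: "(u, v) \<in> parcs H" for u v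
    proof -
      have "f u \<in> \<phi> u" "f v \<in> \<phi> v"
        using f H.arc_fst_in_verts[OF uv] H.arc_snd_in_verts[OF uv] by auto
      with R uv show ?thesis
        unfolding \<phi>_def by blast
    qed
    with f show ?thesis
      by (auto simp: graph_hom_def \<phi>_def)
  qed
  ultimately have "multi_hom H G \<phi>"
    by (auto simp: multi_hom_def \<phi>_def)
  moreover have "x \<in> (\<Pi>\<^sub>E v\<in>pverts H. simplex_face (pverts G) (\<phi> v))"
    using R by (auto simp: simplex_face_def \<phi>_def PiE_iff)
  moreover have "x \<in> (\<Pi>\<^sub>E v\<in>pverts H. topspace (simplex_topology (pverts G)))"
    using R by (simp add: topspace_simplex_topology)
  ultimately show ?l
    by (auto simp: Hom_complex_def)
qed

lemma continuous_map_Hom_complex_iff: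
  "continuous_map X (Hom_complex H G) F \<longleftrightarrow>
     F \<in> topspace X \<rightarrow> topspace (Hom_complex H G) \<and>
     (\<forall>v\<in>pverts H. \<forall>a\<in>pverts G. continuous_map X euclideanreal (\<lambda>p. F p v a))"
    (is "?l \<longleftrightarrow> ?r")
proof -
  have sub: "Hom_complex H G =
      subtopology (product_topology (\<lambda>_. simplex_topology (pverts G)) (pverts H))
        (topspace (Hom_complex H G))"
    by (metis Hom_complex_def subtopology_restrict topspace_subtopology)
  have prod: "F p \<in> (\<Pi>\<^sub>E v\<in>pverts H. simplex_face (pverts G) (pverts G))"
    if "p \<in> topspace X" "F \<in> topspace X \<rightarrow> topspace (Hom_complex H G)" for p
    using that by (auto simp: Hom_complex_def topspace_simplex_topology Pi_iff)
  have "?l \<longleftrightarrow> F \<in> topspace X \<rightarrow> topspace (Hom_complex H G) \<and>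
      F ` topspace X \<subseteq> extensional (pverts H) \<and>
      (\<forall>v\<in>pverts H. continuous_map X (simplex_topology (pverts G)) (\<lambda>p. F p v))"
    by (subst sub) (auto simp: continuous_map_in_subtopology continuous_map_componentwise)
  also have "\<dots> \<longleftrightarrow> ?r"
  proof (intro conj_cong refl)
    assume F: "F \<in> topspace X \<rightarrow> topspace (Hom_complex H G)"
    have "continuous_map X (simplex_topology (pverts G)) (\<lambda>p. F p v) \<longleftrightarrow>
      (\<forall>a\<in>pverts G. continuous_map X euclideanreal (\<lambda>p. F p v a))" if "v \<in> pverts H" for v
    proof -
      have "F p v \<in> simplex_face (pverts G) (pverts G)" if "p \<in> topspace X" for p
        using prod[OF that F] \<open>v \<in> pverts H\<close> by auto
      then show ?thesis
        by (auto simp: simplex_topology_def continuous_map_in_subtopology continuous_map_componentwise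
            simplex_face_def PiE_def)
    qed
    moreover have "F ` topspace X \<subseteq> extensional (pverts H)"
      using prod[OF _ F] by (auto simp: PiE_def)
    ultimately show "(F ` topspace X \<subseteq> extensional (pverts H) \<and>
      (\<forall>v\<in>pverts H. continuous_map X (simplex_topology (pverts G)) (\<lambda>p. F p v))) \<longleftrightarrow>
      (\<forall>v\<in>pverts H. \<forall>a\<in>pverts G. continuous_map X euclideanreal (\<lambda>p. F p v a))"
      by simp
  qed
  finally show ?thesis .
qed

section \<open>Coindices of Hom complexes of cycles\<close>

lemma cycle_graph_arc_iff:
  "(u, v) \<in> parcs (cycle_graph m) \<longleftrightarrow>
     u < m \<and> v < m \<and> (v = Suc u mod m \<or> u = Suc v mod m)"
  by (auto simp: cycle_graph_def)

lemma pair_loopfree_digraph_cycle_graph: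
  assumes "m \<ge> 2"
  shows "pair_loopfree_digraph (cycle_graph m)"
proof
  fix e :: "nat \<times> nat"
  obtain u v where e: "e = (u, v)" by fastforce
  have ne: "w \<noteq> Suc w mod m" if "w < m" for w
    using that assms by (cases "Suc w = m") auto
  assume "e \<in> parcs (cycle_graph m)"
  then show "fst e \<in> pverts (cycle_graph m)" "snd e \<in> pverts (cycle_graph m)" "fst e \<noteq> snd e"
    using ne by (auto simp: e cycle_graph_arc_iff) (auto simp: cycle_graph_def)
qed

lemma pair_loopfree_digraph_K2: "pair_loopfree_digraph K2"
  by unfold_locales (auto simp: K2_def)

text \<open>The contravariant functoriality of the Hom complex in its first argument.\<close>

lemma Z2_map_Hom_pullback:
  fixes G :: "'c pair_pre_digraph" and H :: "'b pair_pre_digraph" and H' :: "'d pair_pre_digraph"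
  assumes H: "pair_loopfree_digraph H" and H': "pair_loopfree_digraph H'"
    and h: "graph_hom H' H h"
    and eq: "\<And>v. v \<in> pverts H' \<Longrightarrow> \<alpha>' v \<in> pverts H' \<and> h (\<alpha>' v) = \<alpha> (h v)"
  shows "Z2_map (Hom_complex H G) (Hom_involution H \<alpha>) (Hom_complex H' G) (Hom_involution H' \<alpha>')
     (\<lambda>x. \<lambda>v\<in>pverts H'. x (h v))"
proof -
  interpret H': pair_loopfree_digraph H' by fact
  have hv: "h v \<in> pverts H" if "v \<in> pverts H'" for v
    using h that by (auto simp: graph_hom_def)
  have ha: "(h u, h v) \<in> parcs H" if "(u, v) \<in> parcs H'" for u v
    using h that by (auto simp: graph_hom_def)
  have "(\<lambda>v\<in>pverts H'. x (h v)) \<in> topspace (Hom_complex H' G)"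
    if x: "x \<in> topspace (Hom_complex H G)" for x
  proof -
    have "x (h v) \<in> simplex_face (pverts G) (pverts G)" if "v \<in> pverts H'" for v
      using x hv[OF that] by (auto simp: topspace_Hom_complex_iff[OF H])
    moreover have "(a, b) \<in> parcs G"
      if "(u, v) \<in> parcs H'" "a \<in> pverts G" "b \<in> pverts G" "x (h u) a \<noteq> 0" "x (h v) b \<noteq> 0" for u v a b
      using x that(2-) ha[OF that(1)] unfolding topspace_Hom_complex_iff[OF H] by blast
    moreover have "u \<in> pverts H' \<and> v \<in> pverts H'" if "(u, v) \<in> parcs H'" for u v
      using H'.arc_fst_in_verts[OF that] H'.arc_snd_in_verts[OF that] by simp
    ultimately show ?thesis
      unfolding topspace_Hom_complex_iff[OF H'] by fastforce
  qed
  moreover have "continuous_map (Hom_complex H G) euclideanreal (\<lambda>x. x v a)"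
    if "v \<in> pverts H" "a \<in> pverts G" for v a
    using continuous_map_id[of "Hom_complex H G", unfolded id_def continuous_map_Hom_complex_iff] that
    by blast
  ultimately have "continuous_map (Hom_complex H G) (Hom_complex H' G) (\<lambda>x. \<lambda>v\<in>pverts H'. x (h v))"
    unfolding continuous_map_Hom_complex_iff using hv by auto
  moreover have "(\<lambda>v\<in>pverts H'. Hom_involution H \<alpha> x (h v)) =
      Hom_involution H' \<alpha>' (\<lambda>v\<in>pverts H'. x (h v))" for x :: "'b \<Rightarrow> 'c \<Rightarrow> real"
    unfolding Hom_involution_def by (rule restrict_ext) (simp add: eq hv)
  ultimately show ?thesis
    by (simp add: Z2_map_def)
qed

lemma Z2_map_compose:
  assumes "Z2_map X \<alpha> Y \<beta> f" and "Z2_map Y \<beta> Z \<gamma> g"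
  shows "Z2_map X \<alpha> Z \<gamma> (g \<circ> f)"
proof -
  have "f x \<in> topspace Y" if "x \<in> topspace X" for x
    using assms(1) that by (auto simp: Z2_map_def dest: continuous_map_funspace)
  with assms show ?thesis
    by (auto simp: Z2_map_def intro: continuous_map_compose)
qed

lemma coind_mono:
  assumes "Z2_map X \<alpha> Y \<beta> g"
  shows "coind X \<alpha> \<le> coind Y \<beta>"
  unfolding coind_def using Z2_map_compose[OF _ assms] by (intro SUP_subset_mono) auto

lemma le_coind:
  assumes "Z2_map (sphere_top k) antipode X \<alpha> f" and "k \<ge> -1"
  shows "ereal (real_of_int k) \<le> coind X \<alpha>"
  unfolding coind_def using assms by (intro SUP_upper) auto

lemma coind_ge_minus_one: "coind X \<alpha> \<ge> -1"
proof -
  have "Z2_map (sphere_top (-1)) antipode X \<alpha> f" for f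
    by (simp add: Z2_map_def sphere_top_def)
  then show ?thesis
    using le_coind[of "-1" X \<alpha>] by (simp add: one_ereal_def)
qed

text \<open>
  The homomorphism \<open>i \<mapsto> i - 1\<close> (mod \<open>m\<close>) from the cycle of length \<open>m + 2\<close> to the cycle of length
  \<open>m\<close> commutes with the two reflections. It folds the three consecutive edges around the edge
  \<open>{m + 1, 0}\<close> onto the single edge \<open>{m - 1, 0}\<close>.
\<close>

lemma coind_Hom_cycle_mono:
  assumes "m \<ge> 2"
  shows "coind_Hom_cycle m G \<le> coind_Hom_cycle (m + 2) G"
proof -
  define h where "h i = (if i = 0 then m - 1 else if i = m + 1 then 0 else i - 1)" for i :: nat
  have Suc_mod: "Suc i mod n = (if Suc i = n then 0 else Suc i)" if "i < n" for i n :: nat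
    using that by auto
  have "graph_hom (cycle_graph (m + 2)) (cycle_graph m) h"
    unfolding graph_hom_def
  proof (intro conjI ballI, goal_cases)
    case (1 v)
    with assms show ?case by (auto simp: cycle_graph_def h_def)
  next
    case (2 e)
    obtain u v where e: "e = (u, v)" by fastforce
    have hlt: "h i < m" if "i < m + 2" for i
      using that assms by (auto simp: h_def)
    \<comment> \<open>the second alternative is the edge \<open>{m + 1, 0}\<close>, which is traversed backwards\<close>
    have step: "h (Suc i mod (m + 2)) = Suc (h i) mod m \<or> h i = Suc (h (Suc i mod (m + 2))) mod m"
      if "i < m + 2" for i
      using that assms by (auto simp: Suc_mod h_def)
    from 2 show ?case
      using hlt step by (auto simp: e cycle_graph_arc_iff)
  qed
  moreover have "(m + 2) - 1 - v \<in> pverts (cycle_graph (m + 2)) \<and> h ((m + 2) - 1 - v) = m - 1 - h v"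
    if "v \<in> pverts (cycle_graph (m + 2))" for v
    using that assms by (auto simp: cycle_graph_def h_def)
  ultimately show ?thesis
    unfolding coind_Hom_cycle_def using assms
    by (intro coind_mono[OF Z2_map_Hom_pullback[where h = h]] pair_loopfree_digraph_cycle_graph) auto
qed

section \<open>Truncation of barycentric coordinates\<close>

text \<open>
  Discarding coordinates of size at most \<open>\<epsilon>\<close> and normalising again. The support of a point of a
  simplex can grow under arbitrarily small perturbations; as long as no coordinate changes by \<open>\<epsilon>\<close> or
  more, however, the truncation of the perturbed point is supported inside the original support.
\<close>

definition truncate :: "real \<Rightarrow> 'b set \<Rightarrow> ('b \<Rightarrow> real) \<Rightarrow> 'b \<Rightarrow> real" where
  "truncate \<epsilon> W t = (\<lambda>w\<in>W. max 0 (t w - \<epsilon>) / (\<Sum>u\<in>W. max 0 (t u - \<epsilon>)))"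

text \<open>
  At most \<open>\<epsilon>\<close> is lost at each of the vertices, so some of the total mass 1 survives.
\<close>

lemma truncate_mass_pos:
  assumes "t \<in> simplex_face W W" and "\<epsilon> * real (card W) < 1"
  shows "(\<Sum>u\<in>W. max 0 (t u - \<epsilon>)) > 0"
proof -
  have "0 < (\<Sum>u\<in>W. t u - \<epsilon>)"
    using assms by (simp add: sum_subtractf simplex_face_def mult.commute)
  also have "\<dots> \<le> (\<Sum>u\<in>W. max 0 (t u - \<epsilon>))"
    by (intro sum_mono) simp
  finally show ?thesis .
qed

lemma truncate_in_simplex:
  assumes "t \<in> simplex_face W W" and "\<epsilon> * real (card W) < 1"
  shows "truncate \<epsilon> W t \<in> simplex_face W W"
  using truncate_mass_pos[OF assms]
  by (auto simp: simplex_face_def truncate_def sum_nonneg simp flip: sum_divide_distrib)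

lemma truncate_nonzeroD: "truncate \<epsilon> W t w \<noteq> 0 \<Longrightarrow> w \<in> W \<Longrightarrow> t w > \<epsilon>"
  by (auto simp: truncate_def max_def split: if_splits)

lemma continuous_map_truncate:
  assumes W: "finite W" "\<epsilon> * real (card W) < 1" "w \<in> W"
    and g: "g \<in> topspace X \<rightarrow> simplex_face W W"
      "\<And>u. u \<in> W \<Longrightarrow> continuous_map X euclideanreal (\<lambda>p. g p u)"
  shows "continuous_map X euclideanreal (\<lambda>p. truncate \<epsilon> W (g p) w)"
proof -
  have "(\<Sum>u\<in>W. max 0 (g p u - \<epsilon>)) \<noteq> 0" if "p \<in> topspace X" for p
    using truncate_mass_pos[of "g p" W \<epsilon>] that g(1) W(2) by force
  with W g(2) have "continuous_map X euclideanreal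
      (\<lambda>p. max 0 (g p w - \<epsilon>) / (\<Sum>u\<in>W. max 0 (g p u - \<epsilon>)))"
    by (intro continuous_intros) auto
  with W(3) show ?thesis
    by (simp add: truncate_def)
qed

section \<open>Meridians of the sphere\<close>

lemma nsphere_eq_top_of_set: "nsphere n = top_of_set (topspace (nsphere n))"
  by (simp add: nsphere euclidean_product_topology)

lemma compact_nsphere: "compact (topspace (nsphere n) :: (nat \<Rightarrow> real) set)"
proof -
  have "compact (PiE UNIV (\<lambda>_. {-1..1}) :: (nat \<Rightarrow> real) set)"
    using compactin_PiE[of "\<lambda>_. euclideanreal" UNIV "\<lambda>_::nat. {-1..1}"]
    by (simp add: euclidean_product_topology)
  moreover have "closed ({x. (\<Sum>i\<le>n. x i ^ 2) = 1} \<inter> (\<Inter>i\<in>{n<..}. {x :: nat \<Rightarrow> real. x i = 0}))"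
    by (intro closed_Int closed_INT ballI closed_Collect_eq continuous_intros
        continuous_on_product_coordinates)
  ultimately have "compact (PiE UNIV (\<lambda>_. {-1..1}) \<inter>
      ({x. (\<Sum>i\<le>n. x i ^ 2) = 1} \<inter> (\<Inter>i\<in>{n<..}. {x :: nat \<Rightarrow> real. x i = 0})))"
    by (rule compact_Int_closed)
  \<comment> \<open>the sphere is a closed subset of a product of compact intervals\<close>
  moreover have "x i \<in> {-1..1}" if "(\<Sum>i\<le>n. x i ^ 2) = 1" "\<And>i. i > n \<Longrightarrow> x i = 0"
    for x :: "nat \<Rightarrow> real" and i
  proof (cases "i \<le> n")
    case True
    then have "x i ^ 2 \<le> 1"
      using member_le_sum[of i "{..n}" "\<lambda>i. x i ^ 2"] that(1) by simp
    then show ?thesis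
      by (simp add: abs_square_le_1 abs_le_iff)
  next
    case False
    then show ?thesis using that(2) by simp
  qed
  then have "PiE UNIV (\<lambda>_. {-1..1}) \<inter>
      ({x. (\<Sum>i\<le>n. x i ^ 2) = 1} \<inter> (\<Inter>i\<in>{n<..}. {x :: nat \<Rightarrow> real. x i = 0})) =
      topspace (nsphere n)"
    unfolding nsphere by auto
  ultimately show ?thesis by simp
qed

text \<open>
  The half circle from \<open>y\<close> on the equator of the \<open>(n + 1)\<close>-sphere, through the pole, to the
  antipode of \<open>y\<close>, parametrised by the unit interval.
\<close>

definition meridian :: "nat \<Rightarrow> (nat \<Rightarrow> real) \<Rightarrow> real \<Rightarrow> nat \<Rightarrow> real" where
  "meridian n y t = (\<lambda>i. if i = Suc n then sin (pi * t) else cos (pi * t) * y i)"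

lemma meridian_in_nsphere:
  assumes "y \<in> topspace (nsphere n)"
  shows "meridian n y t \<in> topspace (nsphere (Suc n))"
proof -
  have "(\<Sum>i\<le>Suc n. meridian n y t i ^ 2) = (\<Sum>i\<le>n. (cos (pi * t) * y i) ^ 2) + sin (pi * t) ^ 2"
    by (simp add: meridian_def)
  also have "(\<Sum>i\<le>n. (cos (pi * t) * y i) ^ 2) = cos (pi * t) ^ 2 * (\<Sum>i\<le>n. y i ^ 2)"
    by (simp add: power_mult_distrib sum_distrib_left)
  finally show ?thesis
    using assms by (simp add: nsphere meridian_def)
qed

text \<open>
  The half circles that belong to antipodal points of the equator are reverses of each other. Thus
  the antipodal action on the equator corresponds to the reflection of the cycle.
\<close>

lemma meridian_antipode: "meridian n (antipode y) t = meridian n y (1 - t)"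
  by (simp add: meridian_def antipode_def right_diff_distrib sin_diff cos_diff fun_eq_iff)

lemma meridian_ends:
  assumes "y \<in> topspace (nsphere n)"
  shows "meridian n y 0 = y" "meridian n y 1 = antipode y"
  using assms by (auto simp: meridian_def antipode_def nsphere fun_eq_iff)

lemma continuous_on_meridian: "continuous_on A (\<lambda>(y, t). meridian n y t)"
  unfolding case_prod_unfold
proof (rule continuous_on_coordinatewise_then_product)
  fix i
  have "continuous_on A (\<lambda>p. fst p i)"
    by (rule continuous_on_product_then_coordinatewise) (rule continuous_on_fst[OF continuous_on_id])
  then show "continuous_on A (\<lambda>p. meridian n (fst p) (snd p) i)"
    by (cases "i = Suc n") (auto simp: meridian_def intro!: continuous_intros)
qed

text \<open>
  By compactness of the equator, a subdivision into equal steps can be chosen that is fine enough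
  for all meridians at once.
\<close>

lemma meridian_uniformly_continuous:
  assumes g: "continuous_map (nsphere (Suc n)) euclideanreal g" and "\<epsilon> > 0"
  shows "\<forall>\<^sub>F r in sequentially. \<forall>y\<in>topspace (nsphere n). \<forall>v<2 * r.
    \<bar>g (meridian n y (v / (2 * r))) - g (meridian n y (Suc v / (2 * r)))\<bar> < \<epsilon>"
proof -
  let ?K = "topspace (nsphere n) \<times> {0..1::real}"
  have "continuous_on (topspace (nsphere (Suc n))) g"
    using g by (subst (asm) nsphere_eq_top_of_set) simp
  then have "continuous_on ?K (\<lambda>p. g ((\<lambda>(y, t). meridian n y t) p))"
    by (rule continuous_on_compose2[OF _ continuous_on_meridian]) (auto simp: meridian_in_nsphere)
  then have "uniformly_continuous_on ?K (\<lambda>p. g ((\<lambda>(y, t). meridian n y t) p))"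
    by (intro compact_uniformly_continuous compact_Times compact_nsphere compact_Icc)
  then obtain \<delta> where "\<delta> > 0" and \<delta>: "\<And>p p'. p \<in> ?K \<Longrightarrow> p' \<in> ?K \<Longrightarrow> dist p' p < \<delta> \<Longrightarrow>
      dist (g ((\<lambda>(y, t). meridian n y t) p')) (g ((\<lambda>(y, t). meridian n y t) p)) < \<epsilon>"
    using \<open>\<epsilon> > 0\<close> unfolding uniformly_continuous_on_def by meson
  obtain N :: nat where N: "1 / \<delta> < N"
    using reals_Archimedean2 by blast
  show ?thesis
    unfolding eventually_sequentially
  proof (intro exI[of _ N] allI impI ballI)
    fix r y v
    assume r: "N \<le> r" and y: "y \<in> topspace (nsphere n)" and v: "v < 2 * r"
    have "1 / \<delta> < 2 * real r"
      using N r by linarith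
    moreover have "r > 0"
      using v by simp
    ultimately have "1 / (2 * real r) < \<delta>"
      using \<open>\<delta> > 0\<close> by (simp add: field_simps)
    moreover define s where "s = v / (2 * r)"
    moreover define s' where "s' = Suc v / (2 * r)"
    ultimately have "\<bar>s - s'\<bar> < \<delta>"
      using \<open>r > 0\<close> by (simp add: diff_divide_distrib[symmetric])
    then have "dist (y, s) (y, s') < \<delta>"
      by (simp add: dist_Pair_Pair dist_real_def)
    moreover have "s \<in> {0..1}" "s' \<in> {0..1}"
      using v \<open>r > 0\<close> by (auto simp: s_def s'_def divide_le_eq)
    ultimately have "\<bar>g (meridian n y s) - g (meridian n y s')\<bar> < \<epsilon>"
      using \<delta>[of "(y, s')" "(y, s)"] y by (simp add: dist_real_def)
    then show "\<bar>g (meridian n y (v / (2 * r))) - g (meridian n y (Suc v / (2 * r)))\<bar> < \<epsilon>"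
      by (simp only: s_def s'_def)
  qed
qed

section \<open>Sampling a sphere of edges along meridians\<close>

text \<open>
  The vertices \<open>0, \<dots>, 2 * r\<close> of the odd cycle are the sample points of the meridian of \<open>y\<close>, and the
  coordinate \<open>X y v\<close> is the truncation of one of the two ends of the edge of \<open>G\<close> over the sample
  point, alternating with the parity of \<open>v\<close>. Neighbouring samples are so close that both truncated
  supports lie in the supports over one common point, where all pairs are arcs. To close the cycle,
  the vertices \<open>2 * r\<close> and \<open>0\<close> have the same parity, but they lie over antipodal points, and by
  equivariance the antipode exchanges the ends of an edge.
\<close>

lemma Z2_map_Hom_cycle_of_Hom_K2:
  fixes G :: "'a pair_pre_digraph"
  assumes G: "finite (pverts G)"
    and f: "Z2_map (nsphere (Suc n)) antipode (Hom_complex K2 G) (Hom_involution K2 (\<lambda>v. 1 - v)) f"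
  obtains r x where "r \<ge> 1" and "Z2_map (nsphere n) antipode (Hom_complex (cycle_graph (2 * r + 1)) G)
      (Hom_involution (cycle_graph (2 * r + 1)) (\<lambda>v. 2 * r + 1 - 1 - v)) x"
proof -
  let ?V = "pverts G"
  have V2: "pverts K2 = {0, 1}"
    by (simp add: K2_def)
  have f_top: "f p \<in> topspace (Hom_complex K2 G)" if "p \<in> topspace (nsphere (Suc n))" for p
    using f that by (auto simp: Z2_map_def dest: continuous_map_funspace)
  have f_simplex: "f p j \<in> simplex_face ?V ?V" if "p \<in> topspace (nsphere (Suc n))" "j \<in> {0, 1}" for p j
    using f_top[OF that(1)] that(2) unfolding topspace_Hom_complex_iff[OF pair_loopfree_digraph_K2] V2
    by auto
  have f_arc: "(a, b) \<in> parcs G"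
    if "p \<in> topspace (nsphere (Suc n))" "j \<in> {0, 1}" "a \<in> ?V" "b \<in> ?V" "f p j a \<noteq> 0" "f p (1 - j) b \<noteq> 0"
    for p j a b
  proof -
    have "(j, 1 - j) \<in> parcs K2"
      using that(2) by (auto simp: K2_def)
    with f_top[OF that(1)] that(3-6) show ?thesis
      unfolding topspace_Hom_complex_iff[OF pair_loopfree_digraph_K2] by blast
  qed
  have f_cont: "continuous_map (nsphere (Suc n)) euclideanreal (\<lambda>p. f p j a)"
    if "j \<in> {0, 1}" "a \<in> ?V" for j a
  proof -
    have "continuous_map (nsphere (Suc n)) (Hom_complex K2 G) f"
      using f by (simp add: Z2_map_def)
    then have "\<forall>j\<in>{0, 1}. \<forall>a\<in>?V. continuous_map (nsphere (Suc n)) euclideanreal (\<lambda>p. f p j a)"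
      unfolding continuous_map_Hom_complex_iff V2 by (rule conjunct2)
    then show ?thesis
      using that by blast
  qed
  have f_antipode: "f (antipode p) j = f p (1 - j)"
    if "p \<in> topspace (nsphere (Suc n))" "j \<in> {0, 1}" for p j
    using f that by (auto simp: Z2_map_def Hom_involution_def V2)

  \<comment> \<open>any positive \<open>\<epsilon>\<close> with \<open>\<epsilon> * card V < 1\<close> would do; the summand 1 makes this strict\<close>
  define \<epsilon> where "\<epsilon> = 1 / (1 + real (card ?V))"
  have \<epsilon>: "\<epsilon> > 0" "\<epsilon> * real (card ?V) < 1"
    by (auto simp: \<epsilon>_def)
  have "\<forall>\<^sub>F r in sequentially. r \<ge> 1 \<and> (\<forall>j\<in>{0, 1}. \<forall>a\<in>?V. \<forall>y\<in>topspace (nsphere n). \<forall>v<2 * r.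
      \<bar>f (meridian n y (v / (2 * r))) j a - f (meridian n y (Suc v / (2 * r))) j a\<bar> < \<epsilon>)"
    using f_cont \<epsilon>(1)
    by (intro eventually_conj eventually_ge_at_top eventually_ball_finite G ballI
        meridian_uniformly_continuous) auto
  from eventually_happens'[OF sequentially_bot this]
  obtain r :: nat where "r \<ge> 1" and r': "\<forall>j\<in>{0, 1}. \<forall>a\<in>?V. \<forall>y\<in>topspace (nsphere n). \<forall>v<2 * r.
      \<bar>f (meridian n y (v / (2 * r))) j a - f (meridian n y (Suc v / (2 * r))) j a\<bar> < \<epsilon>"
    by blast
  define C where "C = cycle_graph (2 * r + 1)"
  have C: "pair_loopfree_digraph C" "pverts C = {..2 * r}"
    using \<open>r \<ge> 1\<close> pair_loopfree_digraph_cycle_graph[of "2 * r + 1"]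
    by (auto simp: C_def cycle_graph_def)
  have C_arc: "u \<le> 2 * r \<and> v \<le> 2 * r \<and>
      (v = Suc u \<and> u < 2 * r \<or> u = Suc v \<and> v < 2 * r \<or> u = 2 * r \<and> v = 0 \<or> v = 2 * r \<and> u = 0)"
    if "(u, v) \<in> parcs C" for u v
    using that by (auto simp: C_def cycle_graph_arc_iff mod_Suc split: if_splits)

  define P where "P y v = meridian n y (real v / (2 * r))" for y v
  have P: "P y v \<in> topspace (nsphere (Suc n))" if "y \<in> topspace (nsphere n)" for y v
    using that by (simp add: P_def meridian_in_nsphere)
  define X where "X y v = truncate \<epsilon> ?V (f (P y v) (v mod 2))" for y v
  have X_simplex: "X y v \<in> simplex_face ?V ?V" if "y \<in> topspace (nsphere n)" for y v
    unfolding X_def using P[OF that] \<epsilon>(2) by (intro truncate_in_simplex f_simplex) auto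
  have mod2: "v mod 2 \<in> {0, 1}" "Suc v mod 2 = 1 - v mod 2" for v :: nat
    by (auto simp: mod_Suc)
  have X_step: "(a, b) \<in> parcs G \<and> (b, a) \<in> parcs G"
    if y: "y \<in> topspace (nsphere n)" and v: "v < 2 * r" and ab: "a \<in> ?V" "b \<in> ?V"
      and nz: "X y v a \<noteq> 0" "X y (Suc v) b \<noteq> 0" for y v a b
  proof -
    have "f (P y v) (v mod 2) a > \<epsilon>" "f (P y (Suc v)) (1 - v mod 2) b > \<epsilon>"
      using truncate_nonzeroD nz ab by (auto simp: X_def mod2(2))
    \<comment> \<open>moves the second end back to the first sample point; only the slack \<open>\<epsilon>\<close> is used up\<close>
    moreover have "\<bar>f (P y v) (1 - v mod 2) b - f (P y (Suc v)) (1 - v mod 2) b\<bar> < \<epsilon>"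
      unfolding P_def using r' mod2(1)[of v] y v ab by auto
    ultimately have "f (P y v) (v mod 2) a \<noteq> 0" "f (P y v) (1 - v mod 2) b \<noteq> 0"
      using \<epsilon>(1) by linarith+
    then show ?thesis
      using f_arc[OF P[OF y, of v], of "v mod 2" a b] f_arc[OF P[OF y, of v], of "1 - v mod 2" b a]
        mod2(1)[of v] ab
      by auto
  qed
  have X_wrap: "(a, b) \<in> parcs G \<and> (b, a) \<in> parcs G"
    if y: "y \<in> topspace (nsphere n)" and ab: "a \<in> ?V" "b \<in> ?V"
      and nz: "X y (2 * r) a \<noteq> 0" "X y 0 b \<noteq> 0" for y a b
  proof -
    have P0: "P y 0 = y" "P y (2 * r) = antipode y"
      using \<open>r \<ge> 1\<close> by (auto simp: P_def meridian_ends[OF y])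
    have yS: "y \<in> topspace (nsphere (Suc n))"
      using P[OF y, of 0] by (simp add: P0)
    have "f y 1 a > \<epsilon>" "f y 0 b > \<epsilon>"
      using truncate_nonzeroD[OF nz(1)[unfolded X_def] ab(1)]
        truncate_nonzeroD[OF nz(2)[unfolded X_def] ab(2)]
        f_antipode[OF yS, of 0] by (auto simp: P0)
    then show ?thesis
      using f_arc[OF yS, of 1 a b] f_arc[OF yS, of 0 b a] ab \<epsilon>(1) by auto
  qed
  have X_arc: "(a, b) \<in> parcs G"
    if y: "y \<in> topspace (nsphere n)" and uv: "(u, v) \<in> parcs C" and ab: "a \<in> ?V" "b \<in> ?V"
      and nz: "X y u a \<noteq> 0" "X y v b \<noteq> 0" for y u v a b
    using C_arc[OF uv] X_step[OF y] X_wrap[OF y] ab nz by blast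
  define x where "x y = (\<lambda>v\<in>{..2 * r}. X y v)" for y
  have "x y \<in> topspace (Hom_complex C G)" if y: "y \<in> topspace (nsphere n)" for y
  proof -
    have "(a, b) \<in> parcs G"
      if "(u, v) \<in> parcs C" "a \<in> ?V" "b \<in> ?V" "x y u a \<noteq> 0" "x y v b \<noteq> 0" for u v a b
      using that(4-) X_arc[OF y that(1-3)] C_arc[OF that(1)] by (simp add: x_def)
    moreover have "x y \<in> (\<Pi>\<^sub>E v\<in>pverts C. simplex_face ?V ?V)"
      using X_simplex[OF y] by (simp add: x_def C(2))
    ultimately show ?thesis
      unfolding topspace_Hom_complex_iff[OF C(1)] by blast
  qed
  moreover have "continuous_map (nsphere n) euclideanreal (\<lambda>y. x y v a)"
    if "v \<in> pverts C" "a \<in> ?V" for v a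
  proof -
    have "continuous_on (topspace (nsphere n)) (\<lambda>y. P y v)"
      unfolding P_def
      using continuous_on_compose2[OF continuous_on_meridian[of UNIV],
          of "topspace (nsphere n)" "\<lambda>y. (y, v / (2 * r))"]
      by (simp add: continuous_on_Pair)
    then have "continuous_map (nsphere n) (nsphere (Suc n)) (\<lambda>y. P y v)"
      by (subst (1 2) nsphere_eq_top_of_set) (auto simp: continuous_map_in_subtopology P)
    from continuous_map_compose[OF this f_cont]
    have "continuous_map (nsphere n) euclideanreal (\<lambda>y. f (P y v) (v mod 2) u)" if "u \<in> ?V" for u
      using that mod2(1)[of v] by (simp add: comp_def)
    then have "continuous_map (nsphere n) euclideanreal (\<lambda>y. X y v a)"
      unfolding X_def using f_simplex P mod2(1)[of v] that(2)
      by (intro continuous_map_truncate G \<epsilon>(2)) auto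
    with that(1) show ?thesis
      by (simp add: x_def C(2))
  qed
  ultimately have "continuous_map (nsphere n) (Hom_complex C G) x"
    unfolding continuous_map_Hom_complex_iff by blast
  moreover have "x (antipode y) = Hom_involution C (\<lambda>v. 2 * r + 1 - 1 - v) (x y)"
    if y: "y \<in> topspace (nsphere n)" for y
  proof -
    have "X (antipode y) v = X y (2 * r - v)" if "v \<le> 2 * r" for v
    proof -
      have "1 - v / (2 * r) = real (2 * r - v) / (2 * r)"
        using that \<open>r \<ge> 1\<close> by (simp add: of_nat_diff field_simps)
      then have "P (antipode y) v = P y (2 * r - v)"
        by (simp add: P_def meridian_antipode)
      moreover have "v mod 2 = (2 * r - v) mod 2"
        using that by (simp add: mod_2_eq_odd)
      ultimately show ?thesis
        by (simp add: X_def)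
    qed
    then show ?thesis
      by (auto simp: x_def Hom_involution_def C(2) fun_eq_iff restrict_def)
  qed
  ultimately show thesis
    using \<open>r \<ge> 1\<close> by (intro that[of r x]) (simp_all add: Z2_map_def C_def)
qed

section \<open>Comparison of the coindices\<close>

text \<open>
  The shift skips \<open>r = 0\<close>, where the cycle of length 1 is a loop, to which \<open>coind_Hom_cycle_mono\<close> does not apply.
\<close>

lemma lim_coind_Hom_cycle:
  "lim (\<lambda>r. coind_Hom_cycle (2 * r + 1) G) = (SUP r. coind_Hom_cycle (2 * Suc r + 1) G)"
proof -
  have "incseq (\<lambda>r. coind_Hom_cycle (2 * Suc r + 1) G)"
    using coind_Hom_cycle_mono[of "2 * Suc r + 1" G for r] by (intro incseq_SucI) simp
  then have "(\<lambda>r. coind_Hom_cycle (2 * Suc r + 1) G) \<longlonglongrightarrow> (SUP r. coind_Hom_cycle (2 * Suc r + 1) G)"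
    by (rule LIMSEQ_SUP)
  then show ?thesis
    by (rule limI[OF LIMSEQ_imp_Suc])
qed

theorem corollary1p7:
  fixes G :: "'a pair_pre_digraph"
  assumes "pair_graph G" and "parcs G \<noteq> {}"
  shows "coind_Hom_K2 G \<le> lim (\<lambda>r. coind_Hom_cycle (2 * r + 1) G) + 1"
proof -
  interpret pair_graph G by fact
  define L where "L = (SUP r. coind_Hom_cycle (2 * Suc r + 1) G)"
  have le_L: "coind_Hom_cycle (2 * r + 1) G \<le> L" if "r \<ge> 1" for r
    unfolding L_def by (rule SUP_upper2[of "r - 1"]) (use that in auto)
  have "- 1 \<le> coind_Hom_cycle (2 * 1 + 1) G"
    unfolding coind_Hom_cycle_def by (rule coind_ge_minus_one)
  also have "\<dots> \<le> L"
    by (rule le_L) simp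
  finally have "- 1 \<le> L" .
  have "ereal (real_of_int k) \<le> L + 1"
    if f: "Z2_map (sphere_top k) antipode (Hom_complex K2 G) (Hom_involution K2 (\<lambda>v. 1 - v)) f"
    for k f
  proof (cases "k \<le> 0")
    case True
    then have "ereal (real_of_int k) \<le> - 1 + 1"
      by (simp add: one_ereal_def)
    also have "\<dots> \<le> L + 1"
      using \<open>- 1 \<le> L\<close> by (rule add_right_mono)
    finally show ?thesis .
  next
    case False
    define n where "n = nat (k - 1)"
    have k: "k = int n + 1" "nat k = Suc n"
      using False by (auto simp: n_def)
    then have "Z2_map (nsphere (Suc n)) antipode (Hom_complex K2 G) (Hom_involution K2 (\<lambda>v. 1 - v)) f"
      using f by (simp add: sphere_top_def)
    then obtain r x where "r \<ge> 1" and x: "Z2_map (nsphere n) antipode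
        (Hom_complex (cycle_graph (2 * r + 1)) G)
        (Hom_involution (cycle_graph (2 * r + 1)) (\<lambda>v. 2 * r + 1 - 1 - v)) x"
      by (rule Z2_map_Hom_cycle_of_Hom_K2[OF pair_finite_verts])
    have "ereal (real_of_int (int n)) \<le> coind_Hom_cycle (2 * r + 1) G"
      unfolding coind_Hom_cycle_def using x by (intro le_coind[of "int n"]) (simp_all add: sphere_top_def)
    also have "\<dots> \<le> L"
      using \<open>r \<ge> 1\<close> by (rule le_L)
    finally have "ereal (real_of_int (int n)) + 1 \<le> L + 1"
      by (rule add_right_mono)
    then show ?thesis
      by (simp add: k one_ereal_def)
  qed
  then have "coind_Hom_K2 G \<le> L + 1"
    unfolding coind_Hom_K2_def coind_def by (intro SUP_least) blast
  then show ?thesis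
    unfolding lim_coind_Hom_cycle L_def .
qed

end
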